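(* Let $H$ be a separable complex Hilbert space and let $\Gamma=[\Gamma_{i+j}]_{i,j\ge 0}$ be an operator-valued Hankel operator, i.e. a bounded operator on $\ell_2(H)$ with this operator matrix, where $\Gamma_k\in B(H)$ for $k\ge 0$. Set $\Gamma_{-1}=0$. The operator-valued Foguel-Hankel operator $$R(S^{*(\infty)},S^{(\infty)};\Gamma)=\begin{bmatrix} S^{*(\infty)} & \Gamma\\ 0 & S^{(\infty)}\end{bmatrix}\in B(\ell_2(H)\oplus \ell_2(H))$$ is similar to a contraction if any one of the following operator matrices defines a bounded operator on $\ell_2(H)$: $$\Gamma D-D^*\Gamma=[(j-i)\Gamma_{i+j-1}]_{i,j\ge 0},\qquad \Gamma D=[j\,\Gamma_{i+j-1}]_{i,j\ge 0},\qquad D^*\Gamma=[i\,\Gamma_{i+j-1}]_{i,j\ge 0}.$$ Here $D=[(i+1)\delta_{i+1}^{j}]_{i,j\ge 0}$ is the differentiation operator.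
   Context: $B(K)$ denotes the bounded linear operators on a Hilbert space $K$. $\ell_2(H)$ is the Hilbert space of square-summable sequences $(h_i)_{i\ge 0}$ in $H$; operator matrices with entries in $B(H)$ are taken with respect to this decomposition: $(Xh)_i=\sum_j X_{ij}h_j$. $\delta_{i+1}^{j}$ is the Kronecker delta, and scalar entries of $D$ are understood as multiples of the identity of $H$; the products $\Gamma D$ and $D^*\Gamma$ are formal matrix products, equal to the explicit matrices displayed. $S^{(\infty)}$ is the unilateral shift on $\ell_2(H)$, $S^{(\infty)}(h_0,h_1,\dots)=(0,h_0,h_1,\dots)$, and $S^{*(\infty)}$ is its adjoint. An operator $T\in B(K)$ is similar to a contraction if there is an invertible $L\in B(K)$ with $\|L^{-1}TL\|\le 1$. *)

theory Defs
  imports "HOL-Analysis.Analysis"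
begin

section \<open>Complex Hilbert spaces\<close>

text \<open>
  A complex inner product space is presented as a real inner product space that carries in
  addition a complex scalar multiplication extending the real one and a sesquilinear form, linear
  in the first argument, whose real part is the real inner product. Positivity of the form and
  the formula for the norm are inherited from the class \<^class>\<open>real_inner\<close> (see
  \<open>cinner_self\<close> below).
\<close>

class complex_inner = real_inner +
  fixes scaleC :: "complex \<Rightarrow> 'a \<Rightarrow> 'a"  (infixr \<open>*\<^sub>C\<close> 75)
    and cinner :: "'a \<Rightarrow> 'a \<Rightarrow> complex"
  assumes scaleC_add_right: "a *\<^sub>C (x + y) = a *\<^sub>C x + a *\<^sub>C y"
    and scaleC_add_left: "(a + b) *\<^sub>C x = a *\<^sub>C x + b *\<^sub>C x"
    and scaleC_scaleC: "a *\<^sub>C b *\<^sub>C x = (a * b) *\<^sub>C x"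
    and scaleR_scaleC: "scaleR r x = complex_of_real r *\<^sub>C x"
    and cinner_commute: "cinner x y = cnj (cinner y x)"
    and cinner_add_left: "cinner (x + y) z = cinner x z + cinner y z"
    and cinner_scaleC_left: "cinner (a *\<^sub>C x) y = a * cinner x y"
    and inner_eq_Re_cinner: "inner x y = Re (cinner x y)"

class chilbert_space = complex_inner + complete_space

lemma scaleC_one [simp]: "1 *\<^sub>C (x::'a::complex_inner) = x"
  using scaleR_scaleC[of 1 x] by simp

lemma scaleC_zero_left [simp]: "0 *\<^sub>C (x::'a::complex_inner) = 0"
  using scaleR_scaleC[of 0 x] by simp

lemma scaleC_zero_right [simp]: "a *\<^sub>C 0 = (0::'a::complex_inner)"
  using scaleC_add_right[of a 0 0] by simp

lemma cinner_add_right: "cinner x (y + z) = cinner x y + cinner x z"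
  using cinner_commute[of x "y + z"] cinner_commute[of x y] cinner_commute[of x z]
  by (simp only: cinner_add_left complex_cnj_add)

lemma cinner_scaleC_right: "cinner x (a *\<^sub>C y) = cnj a * cinner x y"
  using cinner_commute[of x "a *\<^sub>C y"] cinner_commute[of x y]
  by (simp only: cinner_scaleC_left complex_cnj_mult)

lemma cinner_self: "cinner x x = complex_of_real ((norm x)\<^sup>2)"
proof (rule complex_eqI)
  show "Re (cinner x x) = Re (complex_of_real ((norm x)\<^sup>2))"
    using inner_eq_Re_cinner[of x x] by (simp add: power2_norm_eq_inner)
  have "Im (cinner x x) = - Im (cinner x x)"
    by (subst cinner_commute) simp
  then show "Im (cinner x x) = Im (complex_of_real ((norm x)\<^sup>2))"
    by simp
qed

lemma norm_scaleC: "norm (a *\<^sub>C (x::'a::complex_inner)) = cmod a * norm x"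
proof -
  have "complex_of_real ((norm (a *\<^sub>C x))\<^sup>2) = complex_of_real ((cmod a * norm x)\<^sup>2)"
    unfolding cinner_self[symmetric] cinner_scaleC_left cinner_scaleC_right
    by (simp only: cinner_self power_mult_distrib of_real_mult)
       (simp add: complex_norm_square[symmetric] mult_ac flip: of_real_power)
  then have "(norm (a *\<^sub>C x))\<^sup>2 = (cmod a * norm x)\<^sup>2"
    using of_real_eq_iff by blast
  then show ?thesis
    by (simp add: power2_eq_iff_nonneg)
qed

lemma cmod_cinner_le: "cmod (cinner x y) \<le> 2 * (norm x * norm y)"
proof -
  have "Im (cinner x y) = - inner (\<i> *\<^sub>C x) y"
    by (simp add: inner_eq_Re_cinner cinner_scaleC_left)
  then have "\<bar>Im (cinner x y)\<bar> \<le> norm x * norm y"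
    using Cauchy_Schwarz_ineq2[of "\<i> *\<^sub>C x" y] by (simp add: norm_scaleC)
  moreover have "\<bar>Re (cinner x y)\<bar> \<le> norm x * norm y"
    using Cauchy_Schwarz_ineq2[of x y] by (simp add: inner_eq_Re_cinner)
  ultimately show ?thesis
    using cmod_le[of "cinner x y"] by linarith
qed

lemma cinner_eq_imp_eq: "(\<And>x. cinner x y = cinner x (z::'a::complex_inner)) \<Longrightarrow> y = z"
proof -
  assume eq: "\<And>x. cinner x y = cinner x z"
  have "inner (y - z) y = inner (y - z) z"
    by (simp only: inner_eq_Re_cinner eq)
  then have "inner (y - z) (y - z) = 0"
    by (simp add: inner_diff_right)
  then show "y = z" by simp
qed

instantiation complex :: chilbert_space
begin

definition scaleC_complex :: "complex \<Rightarrow> complex \<Rightarrow> complex" where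
  "scaleC_complex a x = a * x"

definition cinner_complex :: "complex \<Rightarrow> complex \<Rightarrow> complex" where
  "cinner_complex x y = x * cnj y"

instance
  by standard (auto simp: scaleC_complex_def cinner_complex_def inner_complex_def algebra_simps
      scaleR_conv_of_real)

end

text \<open>The Hilbert space direct sum of two spaces is their product type.\<close>

instantiation prod :: (complex_inner, complex_inner) complex_inner
begin

definition scaleC_prod :: "complex \<Rightarrow> 'a \<times> 'b \<Rightarrow> 'a \<times> 'b" where
  "scaleC_prod a x = (a *\<^sub>C fst x, a *\<^sub>C snd x)"

definition cinner_prod :: "'a \<times> 'b \<Rightarrow> 'a \<times> 'b \<Rightarrow> complex" where
  "cinner_prod x y = cinner (fst x) (fst y) + cinner (snd x) (snd y)"

instance
proof
  fix a b :: complex and r :: real and x y z :: "'a \<times> 'b"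
  show "a *\<^sub>C (x + y) = a *\<^sub>C x + a *\<^sub>C y"
    by (simp add: scaleC_prod_def scaleC_add_right)
  show "(a + b) *\<^sub>C x = a *\<^sub>C x + b *\<^sub>C x"
    by (simp add: scaleC_prod_def scaleC_add_left)
  show "a *\<^sub>C b *\<^sub>C x = (a * b) *\<^sub>C x"
    by (simp add: scaleC_prod_def scaleC_scaleC)
  show "scaleR r x = complex_of_real r *\<^sub>C x"
    by (simp add: scaleC_prod_def scaleR_scaleC[symmetric] scaleR_prod_def)
  show "cinner x y = cnj (cinner y x)"
    using cinner_commute[of "fst x" "fst y"] cinner_commute[of "snd x" "snd y"]
    by (simp only: cinner_prod_def complex_cnj_add)
  show "cinner (x + y) z = cinner x z + cinner y z"
    by (simp add: cinner_prod_def cinner_add_left)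
  show "cinner (a *\<^sub>C x) y = a * cinner x y"
    by (simp add: cinner_prod_def scaleC_prod_def cinner_scaleC_left algebra_simps)
  show "inner x y = Re (cinner x y)"
    by (simp add: cinner_prod_def inner_prod_def inner_eq_Re_cinner)
qed

end

instance prod :: (chilbert_space, chilbert_space) chilbert_space ..


section \<open>Bounded operators, adjoints, similarity\<close>

definition bounded_clinear :: "('a::complex_inner \<Rightarrow> 'b::complex_inner) \<Rightarrow> bool" where
  "bounded_clinear T \<longleftrightarrow> bounded_linear T \<and> (\<forall>a x. T (a *\<^sub>C x) = a *\<^sub>C T x)"

definition cadjoint :: "('a::complex_inner \<Rightarrow> 'b::complex_inner) \<Rightarrow> 'b \<Rightarrow> 'a" where
  "cadjoint T = (THE T'. \<forall>x y. cinner (T x) y = cinner x (T' y))"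

lemma cadjoint_eqI:
  assumes "\<And>x y. cinner (T x) y = cinner x (T' y)"
  shows "cadjoint T = T'"
  unfolding cadjoint_def
proof (rule the_equality)
  show "\<forall>x y. cinner (T x) y = cinner x (T' y)" using assms by blast
next
  fix T'' assume "\<forall>x y. cinner (T x) y = cinner x (T'' y)"
  then have "cinner x (T'' y) = cinner x (T' y)" for x y using assms by simp
  then show "T'' = T'" by (metis cinner_eq_imp_eq ext)
qed

definition similar_to_contraction :: "('a::chilbert_space \<Rightarrow> 'a) \<Rightarrow> bool" where
  "similar_to_contraction T \<longleftrightarrow> bounded_clinear T \<and>
    (\<exists>(L :: 'a \<Rightarrow> 'a) (L' :: 'a \<Rightarrow> 'a). bounded_clinear L \<and> bounded_clinear L' \<and> L' \<circ> L = id \<and> L \<circ> L' = id \<and>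
            onorm (L' \<circ> T \<circ> L) \<le> 1)"


section \<open>Square-summable sequences\<close>

typedef (overloaded) 'a ell2 =
  "{f :: nat \<Rightarrow> 'a::complex_inner. summable (\<lambda>i. (norm (f i))\<^sup>2)}"
  morphisms ell2_nth Abs_ell2
  by (rule exI[of _ "\<lambda>_. 0"]) simp

setup_lifting type_definition_ell2

lemma summable_ell2: "summable (\<lambda>i. (norm (ell2_nth x i))\<^sup>2)"
  using ell2_nth[of x] by simp

lemma ell2_eqI: "(\<And>i. ell2_nth x i = ell2_nth y i) \<Longrightarrow> x = y"
  by (simp add: ell2_nth_inject[symmetric] fun_eq_iff)

lemma summable_ell2_add:
  fixes f g :: "nat \<Rightarrow> 'a::real_inner"
  assumes "summable (\<lambda>i. (norm (f i))\<^sup>2)" "summable (\<lambda>i. (norm (g i))\<^sup>2)"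
  shows "summable (\<lambda>i. (norm (f i + g i))\<^sup>2)"
proof (rule summable_comparison_test')
  show "summable (\<lambda>i. 2 * ((norm (f i))\<^sup>2 + (norm (g i))\<^sup>2))"
    by (intro summable_mult summable_add assms)
  fix i :: nat
  have "(norm (f i + g i))\<^sup>2 \<le> (norm (f i) + norm (g i))\<^sup>2"
    by (intro power_mono norm_triangle_ineq) simp
  also have "\<dots> \<le> 2 * ((norm (f i))\<^sup>2 + (norm (g i))\<^sup>2)"
    using sum_squares_bound[of "norm (f i)" "norm (g i)"] by (simp add: power2_sum)
  finally show "norm ((norm (f i + g i))\<^sup>2) \<le> 2 * ((norm (f i))\<^sup>2 + (norm (g i))\<^sup>2)"
    by simp
qed

lemma summable_norm_mult_ell2:
  "summable (\<lambda>i. norm (ell2_nth x i) * norm (ell2_nth y i))"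
proof (rule summable_comparison_test')
  show "summable (\<lambda>i. (norm (ell2_nth x i))\<^sup>2 + (norm (ell2_nth y i))\<^sup>2)"
    by (intro summable_add summable_ell2)
  fix i :: nat
  show "norm (norm (ell2_nth x i) * norm (ell2_nth y i))
      \<le> (norm (ell2_nth x i))\<^sup>2 + (norm (ell2_nth y i))\<^sup>2"
    using sum_squares_bound[of "norm (ell2_nth x i)" "norm (ell2_nth y i)"]
      mult_nonneg_nonneg[of "norm (ell2_nth x i)" "norm (ell2_nth y i)"]
    by (simp del: mult_nonneg_nonneg zero_le_mult_iff)
qed

lemma summable_cinner_ell2: "summable (\<lambda>i. cinner (ell2_nth x i) (ell2_nth y i))"
  by (rule summable_comparison_test'[OF summable_mult[OF summable_norm_mult_ell2[of x y], of 2]])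
     (rule cmod_cinner_le)

lemma summable_inner_ell2: "summable (\<lambda>i. inner (ell2_nth x i) (ell2_nth y i))"
  unfolding inner_eq_Re_cinner by (rule summable_Re[OF summable_cinner_ell2])

instantiation ell2 :: (complex_inner) complex_inner
begin

lift_definition zero_ell2 :: "'a ell2" is "\<lambda>_. 0" by simp

lift_definition plus_ell2 :: "'a ell2 \<Rightarrow> 'a ell2 \<Rightarrow> 'a ell2" is "\<lambda>f g i. f i + g i"
  by (rule summable_ell2_add)

lift_definition uminus_ell2 :: "'a ell2 \<Rightarrow> 'a ell2" is "\<lambda>f i. - f i" by simp

lift_definition minus_ell2 :: "'a ell2 \<Rightarrow> 'a ell2 \<Rightarrow> 'a ell2" is "\<lambda>f g i. f i - g i"
  by (simp only: diff_conv_add_uminus, rule summable_ell2_add) simp_all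

lift_definition scaleR_ell2 :: "real \<Rightarrow> 'a ell2 \<Rightarrow> 'a ell2" is "\<lambda>r f i. r *\<^sub>R f i"
  by (simp add: power_mult_distrib summable_mult)

lift_definition scaleC_ell2 :: "complex \<Rightarrow> 'a ell2 \<Rightarrow> 'a ell2" is "\<lambda>a f i. a *\<^sub>C f i"
  by (simp add: norm_scaleC power_mult_distrib summable_mult)

definition inner_ell2 :: "'a ell2 \<Rightarrow> 'a ell2 \<Rightarrow> real" where
  "inner_ell2 x y = (\<Sum>i. inner (ell2_nth x i) (ell2_nth y i))"

definition cinner_ell2 :: "'a ell2 \<Rightarrow> 'a ell2 \<Rightarrow> complex" where
  "cinner_ell2 x y = (\<Sum>i. cinner (ell2_nth x i) (ell2_nth y i))"

definition norm_ell2 :: "'a ell2 \<Rightarrow> real" where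
  "norm_ell2 x = sqrt (inner x x)"

definition sgn_ell2 :: "'a ell2 \<Rightarrow> 'a ell2" where
  "sgn_ell2 x = inverse (norm x) *\<^sub>R x"

definition dist_ell2 :: "'a ell2 \<Rightarrow> 'a ell2 \<Rightarrow> real" where
  "dist_ell2 x y = norm (x - y)"

definition uniformity_ell2 :: "('a ell2 \<times> 'a ell2) filter" where
  "uniformity_ell2 = (INF e\<in>{0<..}. principal {(x, y). dist x y < e})"

definition open_ell2 :: "'a ell2 set \<Rightarrow> bool" where
  "open_ell2 U \<longleftrightarrow> (\<forall>x\<in>U. \<forall>\<^sub>F (x', y) in uniformity. x' = x \<longrightarrow> y \<in> U)"

instance
proof
  fix a b :: complex and r s :: real and x y z :: "'a ell2" and U :: "'a ell2 set"
  show "x + y + z = x + (y + z)" by transfer (simp add: add.assoc)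
  show "x + y = y + x" by transfer (simp add: add.commute)
  show "0 + x = x" by transfer simp
  show "- x + x = 0" by transfer simp
  show "x - y = x + - y" by transfer simp
  show "r *\<^sub>R (x + y) = r *\<^sub>R x + r *\<^sub>R y" by transfer (simp add: scaleR_add_right)
  show "(r + s) *\<^sub>R x = r *\<^sub>R x + s *\<^sub>R x" by transfer (simp add: scaleR_add_left)
  show "r *\<^sub>R s *\<^sub>R x = (r * s) *\<^sub>R x" by transfer simp
  show "1 *\<^sub>R x = x" by transfer simp
  show "sgn x = inverse (norm x) *\<^sub>R x" by (rule sgn_ell2_def)
  show "dist x y = norm (x - y)" by (rule dist_ell2_def)
  show "(uniformity :: ('a ell2 \<times> 'a ell2) filter) = (INF e\<in>{0<..}. principal {(x, y). dist x y < e})"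
    by (rule uniformity_ell2_def)
  show "open U \<longleftrightarrow> (\<forall>x\<in>U. \<forall>\<^sub>F (x', y) in uniformity. x' = x \<longrightarrow> y \<in> U)"
    by (rule open_ell2_def)
  show "inner x y = inner y x" by (simp add: inner_ell2_def inner_commute)
  show "inner (x + y) z = inner x z + inner y z"
    by (simp add: inner_ell2_def plus_ell2.rep_eq inner_add_left
        suminf_add[OF summable_inner_ell2 summable_inner_ell2])
  show "inner (r *\<^sub>R x) y = r * inner x y"
    by (simp add: inner_ell2_def scaleR_ell2.rep_eq suminf_mult summable_inner_ell2)
  show "0 \<le> inner x x"
    by (simp add: inner_ell2_def suminf_nonneg summable_inner_ell2)
  show "inner x x = 0 \<longleftrightarrow> x = 0"
  proof -
    have "inner x x = 0 \<longleftrightarrow> (\<forall>i. inner (ell2_nth x i) (ell2_nth x i) = 0)"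
      unfolding inner_ell2_def by (rule suminf_eq_zero_iff[OF summable_inner_ell2]) simp
    also have "\<dots> \<longleftrightarrow> x = 0"
      by (auto intro: ell2_eqI simp: zero_ell2.rep_eq)
    finally show ?thesis .
  qed
  show "norm x = sqrt (inner x x)" by (rule norm_ell2_def)
  show "a *\<^sub>C (x + y) = a *\<^sub>C x + a *\<^sub>C y" by transfer (simp add: scaleC_add_right)
  show "(a + b) *\<^sub>C x = a *\<^sub>C x + b *\<^sub>C x" by transfer (simp add: scaleC_add_left)
  show "a *\<^sub>C b *\<^sub>C x = (a * b) *\<^sub>C x" by transfer (simp add: scaleC_scaleC)
  show "r *\<^sub>R x = complex_of_real r *\<^sub>C x" by transfer (simp add: scaleR_scaleC)
  show "cinner x y = cnj (cinner y x)"
  proof -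
    have "cnj (cinner y x) = (\<Sum>i. cnj (cinner (ell2_nth y i) (ell2_nth x i)))"
      unfolding cinner_ell2_def
      by (rule bounded_linear.suminf[OF bounded_linear_cnj summable_cinner_ell2])
    then show ?thesis
      by (simp only: cinner_commute[symmetric] cinner_ell2_def)
  qed
  show "cinner (x + y) z = cinner x z + cinner y z"
    by (simp add: cinner_ell2_def plus_ell2.rep_eq cinner_add_left
        suminf_add[OF summable_cinner_ell2 summable_cinner_ell2])
  show "cinner (a *\<^sub>C x) y = a * cinner x y"
    by (simp add: cinner_ell2_def scaleC_ell2.rep_eq cinner_scaleC_left suminf_mult
        summable_cinner_ell2)
  show "inner x y = Re (cinner x y)"
    unfolding inner_ell2_def cinner_ell2_def inner_eq_Re_cinner
    by (simp add: Re_suminf summable_cinner_ell2)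
qed

end

lemma power2_norm_ell2: "(norm x)\<^sup>2 = (\<Sum>i. (norm (ell2_nth x i))\<^sup>2)"
  unfolding power2_norm_eq_inner inner_ell2_def ..

lemma sum_norm_ell2_le: "(\<Sum>i<n. (norm (ell2_nth x i))\<^sup>2) \<le> (norm x)\<^sup>2"
  unfolding power2_norm_ell2 by (rule sum_le_suminf[OF summable_ell2]) auto

lemma norm_ell2_nth_le: "norm (ell2_nth x i) \<le> norm x"
proof -
  have "(norm (ell2_nth x i))\<^sup>2 \<le> (\<Sum>j<Suc i. (norm (ell2_nth x j))\<^sup>2)"
    by (rule member_le_sum) auto
  also have "\<dots> \<le> (norm x)\<^sup>2" by (rule sum_norm_ell2_le)
  finally show ?thesis by (rule power2_le_imp_le) simp
qed

instance ell2 :: (chilbert_space) chilbert_space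
proof
  fix X :: "nat \<Rightarrow> 'a ell2"
  assume X: "Cauchy X"
  have "Cauchy (\<lambda>n. ell2_nth (X n) i)" for i
  proof (rule metric_CauchyI)
    fix e :: real assume "0 < e"
    then obtain M where M: "\<And>m n. m \<ge> M \<Longrightarrow> n \<ge> M \<Longrightarrow> dist (X m) (X n) < e"
      using X unfolding Cauchy_def by blast
    have "dist (ell2_nth (X m) i) (ell2_nth (X n) i) < e" if "m \<ge> M" "n \<ge> M" for m n
      using M[OF that] norm_ell2_nth_le[of "X m - X n" i]
      by (simp add: dist_norm minus_ell2.rep_eq)
    then show "\<exists>M. \<forall>m\<ge>M. \<forall>n\<ge>M. dist (ell2_nth (X m) i) (ell2_nth (X n) i) < e" by blast
  qed
  then have "\<exists>l. (\<lambda>n. ell2_nth (X n) i) \<longlonglongrightarrow> l" for i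
    using Cauchy_convergent convergent_def by blast
  then obtain l where l: "\<And>i. (\<lambda>n. ell2_nth (X n) i) \<longlonglongrightarrow> l i" by metis
  have tail: "\<exists>M. \<forall>m\<ge>M. \<forall>k. (\<Sum>i<k. (norm (ell2_nth (X m) i - l i))\<^sup>2) \<le> e\<^sup>2" if "0 < e" for e
  proof -
    obtain M where M: "\<And>m n. m \<ge> M \<Longrightarrow> n \<ge> M \<Longrightarrow> dist (X m) (X n) < e"
      using X \<open>0 < e\<close> unfolding Cauchy_def by blast
    have "(\<Sum>i<k. (norm (ell2_nth (X m) i - l i))\<^sup>2) \<le> e\<^sup>2" if "m \<ge> M" for m k
    proof (rule LIMSEQ_le_const2)
      show "(\<lambda>n. \<Sum>i<k. (norm (ell2_nth (X m) i - ell2_nth (X n) i))\<^sup>2)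
          \<longlonglongrightarrow> (\<Sum>i<k. (norm (ell2_nth (X m) i - l i))\<^sup>2)"
        by (intro tendsto_intros l)
      have "(\<Sum>i<k. (norm (ell2_nth (X m) i - ell2_nth (X n) i))\<^sup>2) \<le> e\<^sup>2" if "n \<ge> M" for n
      proof -
        have "(\<Sum>i<k. (norm (ell2_nth (X m) i - ell2_nth (X n) i))\<^sup>2) \<le> (norm (X m - X n))\<^sup>2"
          using sum_norm_ell2_le[where x = "X m - X n" and n = k] by (simp add: minus_ell2.rep_eq)
        also have "\<dots> \<le> e\<^sup>2"
          using M[OF \<open>m \<ge> M\<close> that] by (intro power_mono) (auto simp: dist_norm)
        finally show ?thesis .
      qed
      then show "\<exists>N. \<forall>n\<ge>N. (\<Sum>i<k. (norm (ell2_nth (X m) i - ell2_nth (X n) i))\<^sup>2) \<le> e\<^sup>2"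
        by blast
    qed
    then show ?thesis by blast
  qed
  have diff: "summable (\<lambda>i. (norm (ell2_nth (X m) i - l i))\<^sup>2)"
    if "\<forall>k. (\<Sum>i<k. (norm (ell2_nth (X m) i - l i))\<^sup>2) \<le> e\<^sup>2" for m e
    using that by (intro summableI_nonneg_bounded[where x = "e\<^sup>2"]) auto
  obtain m where "\<forall>k. (\<Sum>i<k. (norm (ell2_nth (X m) i - l i))\<^sup>2) \<le> 1\<^sup>2"
    using tail[of 1] by force
  from summable_ell2_add[OF summable_ell2[of "- X m"] diff[OF this]]
  have "summable (\<lambda>i. (norm (l i))\<^sup>2)"
    by (simp add: uminus_ell2.rep_eq)
  then have nth: "ell2_nth (Abs_ell2 l) = l" by (simp add: Abs_ell2_inverse)
  have "X \<longlonglongrightarrow> Abs_ell2 l"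
  proof (rule metric_LIMSEQ_I)
    fix e :: real assume "0 < e"
    then obtain M
      where M: "\<And>m k. m \<ge> M \<Longrightarrow> (\<Sum>i<k. (norm (ell2_nth (X m) i - l i))\<^sup>2) \<le> (e/2)\<^sup>2"
      using tail[of "e/2"] by auto
    have "dist (X m) (Abs_ell2 l) < e" if "m \<ge> M" for m
    proof -
      have "(norm (X m - Abs_ell2 l))\<^sup>2 = (\<Sum>i. (norm (ell2_nth (X m) i - l i))\<^sup>2)"
        by (simp add: power2_norm_ell2 minus_ell2.rep_eq nth)
      also have "\<dots> \<le> (e/2)\<^sup>2"
        using M[OF that] by (intro suminf_le_const diff[of _ "e/2"]) auto
      finally have "norm (X m - Abs_ell2 l) \<le> e/2"
        by (rule power2_le_imp_le) (use \<open>0 < e\<close> in simp)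
      then show ?thesis using \<open>0 < e\<close> by (simp add: dist_norm)
    qed
    then show "\<exists>M. \<forall>m\<ge>M. dist (X m) (Abs_ell2 l) < e" by blast
  qed
  then show "convergent X" by (rule convergentI)
qed

lift_definition shift :: "'a::complex_inner ell2 \<Rightarrow> 'a ell2"
  is "\<lambda>f i. case i of 0 \<Rightarrow> 0 | Suc k \<Rightarrow> f k"
  by (subst summable_Suc_iff[symmetric]) simp

lift_definition backward_shift :: "'a::complex_inner ell2 \<Rightarrow> 'a ell2" is "\<lambda>f i. f (Suc i)"
  by (subst summable_Suc_iff)

lemma cadjoint_shift: "cadjoint shift = backward_shift"
proof (rule cadjoint_eqI)
  fix x y :: "'a ell2"
  show "cinner (shift x) y = cinner x (backward_shift y)"
  proof -
    have "cinner (ell2_nth (shift x) 0) (ell2_nth y 0) = 0"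
      using cinner_scaleC_left[of 0 0 "ell2_nth y 0"] by (simp add: shift.rep_eq)
    then have "cinner (shift x) y = (\<Sum>i. cinner (ell2_nth (shift x) (Suc i)) (ell2_nth y (Suc i)))"
      unfolding cinner_ell2_def
      using suminf_split_head[OF summable_cinner_ell2[of "shift x" y]] by simp
    then show ?thesis
      by (simp only: cinner_ell2_def shift.rep_eq backward_shift.rep_eq nat.case)
  qed
qed


section \<open>Operator matrices\<close>

type_synonym 'a opmat = "nat \<Rightarrow> nat \<Rightarrow> 'a \<Rightarrow> 'a"

definition has_opmat :: "('a::complex_inner ell2 \<Rightarrow> 'a ell2) \<Rightarrow> 'a opmat \<Rightarrow> bool" where
  "has_opmat T X \<longleftrightarrow> (\<forall>h i. (\<lambda>j. X i j (ell2_nth h j)) sums ell2_nth (T h) i)"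

definition defines_bounded_operator :: "'a::complex_inner opmat \<Rightarrow> bool" where
  "defines_bounded_operator X \<longleftrightarrow> (\<exists>T. bounded_clinear T \<and> has_opmat T X)"

text \<open>
  The formal product of operator matrices is meant for matrices for which the entrywise series
  has only finitely many nonzero terms, as is the case below, where one factor is
  \<open>diff_opmat\<close> or its adjoint.
\<close>

definition opmat_mult :: "'a::complex_inner opmat \<Rightarrow> 'a opmat \<Rightarrow> 'a opmat" where
  "opmat_mult X Y = (\<lambda>i j h. \<Sum>k. X i k (Y k j h))"

definition opmat_minus :: "'a::complex_inner opmat \<Rightarrow> 'a opmat \<Rightarrow> 'a opmat" where
  "opmat_minus X Y = (\<lambda>i j h. X i j h - Y i j h)"

definition opmat_adjoint :: "'a::complex_inner opmat \<Rightarrow> 'a opmat" where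
  "opmat_adjoint X = (\<lambda>i j. cadjoint (X j i))"

definition hankel_opmat :: "(nat \<Rightarrow> 'a \<Rightarrow> 'a) \<Rightarrow> 'a::complex_inner opmat" where
  "hankel_opmat G = (\<lambda>i j. G (i + j))"

definition diff_opmat :: "'a::complex_inner opmat" where
  "diff_opmat = (\<lambda>i j h. (of_nat (i + 1) * (if i + 1 = j then 1 else 0)) *\<^sub>C h)"

text \<open>The sequence \<open>G\<close> extended by \<open>0\<close> to negative indices; only the index \<open>-1\<close> is used.\<close>

definition ext_coeff :: "(nat \<Rightarrow> 'a \<Rightarrow> 'a) \<Rightarrow> int \<Rightarrow> 'a \<Rightarrow> 'a::complex_inner" where
  "ext_coeff G k = (if k < 0 then (\<lambda>_. 0) else G (nat k))"

text \<open>The block operator \<open>R(A, B; C)\<close> with rows \<open>(A, C)\<close> and \<open>(0, B)\<close>.\<close>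

definition block_upper ::
  "('a::complex_inner \<Rightarrow> 'a) \<Rightarrow> ('b::complex_inner \<Rightarrow> 'b) \<Rightarrow> ('b \<Rightarrow> 'a) \<Rightarrow> 'a \<times> 'b \<Rightarrow> 'a \<times> 'b" where
  "block_upper A B C = (\<lambda>(x, y). (A x + C y, B y))"

end

theory Submission
  imports Defs
begin

text \<open>
  A block upper triangular operator with diagonal \<open>A\<close>, \<open>B\<close> and corner \<open>C\<close> is similar to the
  diagonal one as soon as the corner is a generalized commutator \<open>C = X B - A X\<close> with \<open>X\<close> bounded:
  conjugation by the invertible unipotent operator \<open>(x, y) \<mapsto> (x + X y, y)\<close> removes the corner. For
  \<open>A = S\<^sup>*\<close> and \<open>B = S\<close> the diagonal operator is a contraction, so it suffices to solve
  \<open>X S - S\<^sup>* X = \<Gamma>\<close>.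

  Right multiplication by \<open>S\<close> deletes the first column of an operator matrix, left multiplication
  by \<open>S\<^sup>*\<close> deletes its first row. Hence the equation reads entrywise
  \<open>X\<^sub>i\<^sub>,\<^sub>j\<^sub>+\<^sub>1 - X\<^sub>i\<^sub>+\<^sub>1\<^sub>,\<^sub>j = \<Gamma>\<^sub>i\<^sub>+\<^sub>j\<close>. Any matrix of the form
  \<open>X\<^sub>i\<^sub>j = (\<alpha> j - \<beta> i) \<Gamma>\<^sub>i\<^sub>+\<^sub>j\<^sub>-\<^sub>1\<close> has the difference \<open>(\<alpha> + \<beta>) \<Gamma>\<^sub>i\<^sub>+\<^sub>j\<close>. The three
  matrices of the theorem are of this form with \<open>(\<alpha>, \<beta>) = (1, 1)\<close>, \<open>(1, 0)\<close> and \<open>(0, -1)\<close>, so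
  that multiples of them by \<open>1/2\<close>, \<open>1\<close> and \<open>-1\<close> solve the equation; whichever of them
  is bounded provides the required \<open>X\<close>.
\<close>

section \<open>Bounded complex linear operators\<close>

lemma bounded_clinearD:
  assumes "bounded_clinear T"
  shows "bounded_linear T" "T (a *\<^sub>C x) = a *\<^sub>C T x" "T (x + y) = T x + T y" "T 0 = 0"
proof -
  show bl: "bounded_linear T"
    using assms by (simp add: bounded_clinear_def)
  show "T (a *\<^sub>C x) = a *\<^sub>C T x"
    using assms by (simp add: bounded_clinear_def)
  show "T (x + y) = T x + T y" "T 0 = 0"
    using bl by (auto simp: linear_simps)
qed

lemma scaleC_minus_left: "(- a) *\<^sub>C x = - (a *\<^sub>C (x :: 'a::complex_inner))"
  using scaleC_add_left[of a "- a" x] by (simp add: eq_neg_iff_add_eq_0 add.commute)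

lemma scaleC_diff_left: "(a - b) *\<^sub>C x = a *\<^sub>C x - b *\<^sub>C (x :: 'a::complex_inner)"
  using scaleC_add_left[of a "- b" x] by (simp add: scaleC_minus_left)

lemma bounded_linear_scaleC: "bounded_linear (\<lambda>x :: 'a::complex_inner. a *\<^sub>C x)"
  by (rule bounded_linear_intro[where K = "cmod a"])
     (simp_all add: scaleC_add_right scaleR_scaleC scaleC_scaleC mult.commute norm_scaleC)

lemma bounded_clinear_scaleC_comp:
  assumes "bounded_clinear T"
  shows "bounded_clinear (\<lambda>x. a *\<^sub>C T x)"
  unfolding bounded_clinear_def
  using bounded_linear_compose[OF bounded_linear_scaleC bounded_clinearD(1)[OF assms]]
  by (simp add: bounded_clinearD(2)[OF assms] scaleC_scaleC mult.commute)

lemma norm_shift: "norm (shift x) = norm x"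
proof -
  have "(norm (shift x))\<^sup>2 = (\<Sum>i. (norm (ell2_nth (shift x) (Suc i)))\<^sup>2)"
    unfolding power2_norm_ell2
    using suminf_split_head[OF summable_ell2[of "shift x"]] by (simp add: shift.rep_eq)
  also have "\<dots> = (norm x)\<^sup>2"
    by (simp add: power2_norm_ell2 shift.rep_eq)
  finally show ?thesis
    by (simp add: power2_eq_iff_nonneg)
qed

lemma norm_backward_shift_le: "norm (backward_shift x) \<le> norm x"
proof -
  have "(norm (backward_shift x))\<^sup>2 \<le> (norm x)\<^sup>2"
    unfolding power2_norm_ell2
    using suminf_split_head[OF summable_ell2[of x]] by (simp add: backward_shift.rep_eq)
  then show ?thesis
    by (rule power2_le_imp_le) simp
qed

lemma bounded_clinear_shift: "bounded_clinear (shift :: 'a::complex_inner ell2 \<Rightarrow> 'a ell2)"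
  unfolding bounded_clinear_def
proof (intro conjI allI)
  show "bounded_linear (shift :: 'a ell2 \<Rightarrow> 'a ell2)"
    by (rule bounded_linear_intro[where K = 1])
       (auto intro!: ell2_eqI simp: shift.rep_eq plus_ell2.rep_eq scaleR_ell2.rep_eq norm_shift
         split: nat.split)
  show "shift (a *\<^sub>C x) = a *\<^sub>C shift x" for a and x :: "'a ell2"
    by (auto intro!: ell2_eqI simp: shift.rep_eq scaleC_ell2.rep_eq split: nat.split)
qed

lemma bounded_clinear_backward_shift:
  "bounded_clinear (backward_shift :: 'a::complex_inner ell2 \<Rightarrow> 'a ell2)"
  unfolding bounded_clinear_def
proof (intro conjI allI)
  show "bounded_linear (backward_shift :: 'a ell2 \<Rightarrow> 'a ell2)"
    by (rule bounded_linear_intro[where K = 1])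
       (auto intro!: ell2_eqI simp: backward_shift.rep_eq plus_ell2.rep_eq scaleR_ell2.rep_eq
         norm_backward_shift_le)
  show "backward_shift (a *\<^sub>C x) = a *\<^sub>C backward_shift x" for a and x :: "'a ell2"
    by (auto intro!: ell2_eqI simp: backward_shift.rep_eq scaleC_ell2.rep_eq)
qed


section \<open>Removing the corner of a block triangular operator\<close>

lemma bounded_clinear_block_upper:
  assumes "bounded_clinear A" "bounded_clinear B" "bounded_clinear C"
  shows "bounded_clinear (block_upper A B C)"
proof -
  have "bounded_linear (\<lambda>p. (A (fst p) + C (snd p), B (snd p)))"
    by (intro bounded_linear_Pair bounded_linear_add bounded_linear_compose[OF _ bounded_linear_fst]
        bounded_linear_compose[OF _ bounded_linear_snd] bounded_clinearD(1) assms)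
  then show ?thesis
    by (auto simp: bounded_clinear_def block_upper_def scaleC_prod_def split_def
        scaleC_add_right bounded_clinearD(2)[OF assms(1)] bounded_clinearD(2)[OF assms(2)]
        bounded_clinearD(2)[OF assms(3)])
qed

text \<open>
  Conjugation by the unipotent operator with corner \<open>X\<close> turns the corner \<open>C\<close> into
  \<open>C + A X - X B\<close>, which vanishes by the last hypothesis.
\<close>

lemma similar_to_contraction_block_upper:
  fixes A :: "'a::chilbert_space \<Rightarrow> 'a" and B :: "'b::chilbert_space \<Rightarrow> 'b"
  assumes A: "bounded_clinear A" and B: "bounded_clinear B" and C: "bounded_clinear C"
    and X: "bounded_clinear X"
    and contr_A: "\<And>x. norm (A x) \<le> norm x" and contr_B: "\<And>y. norm (B y) \<le> norm y"
    and comm: "\<And>y. X (B y) - A (X y) = C y"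
  shows "similar_to_contraction (block_upper A B C)"
proof -
  define L where "L = block_upper id id X"
  define L' where "L' = block_upper id id (\<lambda>y. (- 1) *\<^sub>C X y)"
  have id: "bounded_clinear (id :: 'c::complex_inner \<Rightarrow> 'c)"
    by (simp add: bounded_clinear_def id_def bounded_linear_ident)
  have L: "L p = (fst p + X (snd p), snd p)" and L': "L' p = (fst p - X (snd p), snd p)" for p
    by (simp_all add: L_def L'_def block_upper_def case_prod_beta scaleC_minus_left)
  have "bounded_clinear L" "bounded_clinear L'"
    unfolding L_def L'_def by (intro bounded_clinear_block_upper bounded_clinear_scaleC_comp id X)+
  moreover have "L' \<circ> L = id" "L \<circ> L' = id"
    by (simp_all add: fun_eq_iff L L')
  moreover have "onorm (L' \<circ> block_upper A B C \<circ> L) \<le> 1"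
  proof (rule onorm_bound)
    fix p :: "'a \<times> 'b"
    have "(L' \<circ> block_upper A B C \<circ> L) p = (A (fst p), B (snd p))"
      by (simp add: L L' block_upper_def case_prod_beta bounded_clinearD(3)[OF A]
          comm[symmetric] algebra_simps)
    also have "norm \<dots> \<le> norm p"
      unfolding norm_prod_def fst_conv snd_conv
      by (intro real_sqrt_le_mono add_mono power_mono contr_A contr_B norm_ge_zero)
    finally show "norm ((L' \<circ> block_upper A B C \<circ> L) p) \<le> 1 * norm p"
      by simp
  qed simp
  ultimately show ?thesis
    unfolding similar_to_contraction_def using bounded_clinear_block_upper[OF A B C] by blast
qed


section \<open>The commutator equation for operator matrices\<close>

text \<open>
  Since \<open>S\<close> moves the columns and \<open>S\<^sup>*\<close> the rows of a matrix by one, the series for the two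
  products can be subtracted term by term.
\<close>

lemma has_opmat_shift_commutator:
  assumes T: "has_opmat T X" and \<Gamma>: "has_opmat \<Gamma> M"
    and zero: "\<And>i. X i 0 0 = 0"
    and diff: "\<And>i j h. X i (Suc j) h - X (Suc i) j h = c *\<^sub>C M i j h"
  shows "T (shift y) - backward_shift (T y) = c *\<^sub>C \<Gamma> y"
proof (rule ell2_eqI)
  fix i
  have "(\<lambda>j. X i j (ell2_nth (shift y) j)) sums ell2_nth (T (shift y)) i"
    using T by (simp add: has_opmat_def)
  \<comment> \<open>The first coordinate of a shifted vector is \<open>0\<close>, so the first column contributes nothing.\<close>
  then have "(\<lambda>j. X i (Suc j) (ell2_nth y j)) sums ell2_nth (T (shift y)) i"
    using sums_Suc_iff[of "\<lambda>j. X i j (ell2_nth (shift y) j)"] by (simp add: shift.rep_eq zero)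
  moreover have "(\<lambda>j. X (Suc i) j (ell2_nth y j)) sums ell2_nth (T y) (Suc i)"
    using T by (simp add: has_opmat_def)
  ultimately have "(\<lambda>j. X i (Suc j) (ell2_nth y j) - X (Suc i) j (ell2_nth y j)) sums
      (ell2_nth (T (shift y)) i - ell2_nth (T y) (Suc i))"
    by (rule sums_diff)
  moreover have "(\<lambda>j. c *\<^sub>C M i j (ell2_nth y j)) sums (c *\<^sub>C ell2_nth (\<Gamma> y) i)"
    using \<Gamma> by (intro bounded_linear.sums[OF bounded_linear_scaleC]) (simp add: has_opmat_def)
  ultimately show "ell2_nth (T (shift y) - backward_shift (T y)) i = ell2_nth (c *\<^sub>C \<Gamma> y) i"
    by (simp add: diff minus_ell2.rep_eq backward_shift.rep_eq scaleC_ell2.rep_eq sums_unique2)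
qed

lemma similar_to_contraction_block_shift:
  fixes \<Gamma> :: "'h::chilbert_space ell2 \<Rightarrow> 'h ell2"
  assumes "bounded_clinear \<Gamma>" "has_opmat \<Gamma> M" "defines_bounded_operator X"
    and "\<And>i. X i 0 0 = 0"
    and "\<And>i j h. X i (Suc j) h - X (Suc i) j h = c *\<^sub>C M i j h" and "c \<noteq> 0"
  shows "similar_to_contraction (block_upper (cadjoint shift) shift \<Gamma>)"
proof -
  obtain T where T: "bounded_clinear T" "has_opmat T X"
    using assms(3) by (auto simp: defines_bounded_operator_def)
  have "inverse c *\<^sub>C T (shift y) - backward_shift (inverse c *\<^sub>C T y) = \<Gamma> y" for y
  proof -
    have "inverse c *\<^sub>C T (shift y) - backward_shift (inverse c *\<^sub>C T y)
        = inverse c *\<^sub>C (T (shift y) - backward_shift (T y))"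
      by (simp add: bounded_clinearD(2)[OF bounded_clinear_backward_shift]
          linear_diff[OF bounded_linear.linear[OF bounded_linear_scaleC]])
    also have "\<dots> = \<Gamma> y"
      using has_opmat_shift_commutator[OF T(2) assms(2,4,5)] \<open>c \<noteq> 0\<close> by (simp add: scaleC_scaleC)
    finally show ?thesis .
  qed
  then show ?thesis
    unfolding cadjoint_shift
    by (intro similar_to_contraction_block_upper[where X = "\<lambda>y. inverse c *\<^sub>C T y"]
        bounded_clinear_scaleC_comp T(1) bounded_clinear_shift bounded_clinear_backward_shift assms(1)
        norm_backward_shift_le) (simp_all add: norm_shift)
qed


section \<open>Products with the differentiation matrix\<close>

lemma hankel_mult_diff_opmat:
  assumes G: "\<And>k. bounded_clinear (G k)"
  shows "opmat_mult (hankel_opmat G) diff_opmat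
    = (\<lambda>i j h. of_nat j *\<^sub>C ext_coeff G (int i + int j - 1) h)"
proof (intro ext)
  fix i j h
  show "opmat_mult (hankel_opmat G) diff_opmat i j h
      = of_nat j *\<^sub>C ext_coeff G (int i + int j - 1) h"
  proof (cases j)
    case 0
    then show ?thesis
      by (simp add: opmat_mult_def hankel_opmat_def diff_opmat_def bounded_clinearD(4)[OF G])
  next
    case (Suc k)
    have "opmat_mult (hankel_opmat G) diff_opmat i j h
        = (\<Sum>l\<in>{k}. G (i + l) (diff_opmat l j h))"
      unfolding opmat_mult_def hankel_opmat_def
      by (rule suminf_finite) (auto simp: Suc diff_opmat_def bounded_clinearD(4)[OF G])
    then show ?thesis
      by (simp add: Suc diff_opmat_def ext_coeff_def bounded_clinearD(2)[OF G] nat_add_distrib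
          flip: of_nat_add)
  qed
qed

lemma opmat_adjoint_diff_opmat:
  "opmat_adjoint diff_opmat = (\<lambda>i k h. (of_nat (k + 1) * (if k + 1 = i then 1 else 0)) *\<^sub>C h)"
  unfolding opmat_adjoint_def diff_opmat_def
  by (intro ext, subst cadjoint_eqI) (auto simp: cinner_scaleC_left cinner_scaleC_right)

lemma adjoint_diff_opmat_mult_hankel:
  "opmat_mult (opmat_adjoint diff_opmat) (hankel_opmat G)
    = (\<lambda>i j h. of_nat i *\<^sub>C ext_coeff G (int i + int j - 1) h)"
proof (intro ext)
  fix i j h
  show "opmat_mult (opmat_adjoint diff_opmat) (hankel_opmat G) i j h
      = of_nat i *\<^sub>C ext_coeff G (int i + int j - 1) h"
  proof (cases i)
    case 0
    then show ?thesis
      by (simp add: opmat_mult_def hankel_opmat_def opmat_adjoint_diff_opmat)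
  next
    case (Suc k)
    have "opmat_mult (opmat_adjoint diff_opmat) (hankel_opmat G) i j h
        = (\<Sum>l\<in>{k}. opmat_adjoint diff_opmat i l (G (l + j) h))"
      unfolding opmat_mult_def hankel_opmat_def
      by (rule suminf_finite) (auto simp: Suc opmat_adjoint_diff_opmat)
    then show ?thesis
      by (simp add: Suc opmat_adjoint_diff_opmat ext_coeff_def nat_add_distrib flip: of_nat_add)
  qed
qed

lemma ext_coeff_of_nat [simp]: "ext_coeff G (int n) = G n"
  by (simp add: ext_coeff_def)

text \<open>
  The family \<open>(\<alpha> j - \<beta> i) \<Gamma>\<^sub>i\<^sub>+\<^sub>j\<^sub>-\<^sub>1\<close> enters only through its weight \<open>w i j\<close>, which has to grow by
  the same amount \<open>c\<close> whenever an antidiagonal is followed one step to the upper right.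
\<close>

lemma similar_to_contraction_weighted_hankel:
  fixes \<Gamma> :: "'h::chilbert_space ell2 \<Rightarrow> 'h ell2"
  assumes G: "\<And>k. bounded_clinear (G k)"
    and \<Gamma>: "bounded_clinear \<Gamma>" "has_opmat \<Gamma> (hankel_opmat G)"
    and bdd: "defines_bounded_operator (\<lambda>i j h. w i j *\<^sub>C ext_coeff G (int i + int j - 1) h)"
    and w: "\<And>i j. w i (Suc j) - w (Suc i) j = c" and "c \<noteq> 0"
  shows "similar_to_contraction (block_upper (cadjoint shift) shift \<Gamma>)"
proof (rule similar_to_contraction_block_shift[OF \<Gamma> bdd _ _ \<open>c \<noteq> 0\<close>])
  show "w i 0 *\<^sub>C ext_coeff G (int i + int 0 - 1) 0 = 0" for i
    by (simp add: ext_coeff_def bounded_clinearD(4)[OF G])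
  fix i j h
  have "int i + int (Suc j) - 1 = int (i + j)" "int (Suc i) + int j - 1 = int (i + j)"
    by simp_all
  then show "w i (Suc j) *\<^sub>C ext_coeff G (int i + int (Suc j) - 1) h
      - w (Suc i) j *\<^sub>C ext_coeff G (int (Suc i) + int j - 1) h = c *\<^sub>C hankel_opmat G i j h"
    by (simp only: ext_coeff_of_nat hankel_opmat_def w[symmetric, of i j] scaleC_diff_left)
qed


section \<open>Foguel-Hankel operators\<close>

theorem theorem2p2:
  fixes G :: "nat \<Rightarrow> 'h::chilbert_space \<Rightarrow> 'h"
    and \<Gamma> :: "'h ell2 \<Rightarrow> 'h ell2"
  assumes "separable_space (euclidean :: 'h topology)"
    and "\<And>k. bounded_clinear (G k)"
    and "bounded_clinear \<Gamma>"
    and "has_opmat \<Gamma> (hankel_opmat G)"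
  shows
    "opmat_minus (opmat_mult (hankel_opmat G) diff_opmat)
                 (opmat_mult (opmat_adjoint diff_opmat) (hankel_opmat G))
       = (\<lambda>i j h. of_int (int j - int i) *\<^sub>C ext_coeff G (int i + int j - 1) h) \<and>
     opmat_mult (hankel_opmat G) diff_opmat
       = (\<lambda>i j h. of_nat j *\<^sub>C ext_coeff G (int i + int j - 1) h) \<and>
     opmat_mult (opmat_adjoint diff_opmat) (hankel_opmat G)
       = (\<lambda>i j h. of_nat i *\<^sub>C ext_coeff G (int i + int j - 1) h) \<and>
     (defines_bounded_operator
         (opmat_minus (opmat_mult (hankel_opmat G) diff_opmat)
                      (opmat_mult (opmat_adjoint diff_opmat) (hankel_opmat G))) \<or>
       defines_bounded_operator (opmat_mult (hankel_opmat G) diff_opmat) \<or>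
       defines_bounded_operator (opmat_mult (opmat_adjoint diff_opmat) (hankel_opmat G))
      \<longrightarrow> similar_to_contraction (block_upper (cadjoint shift) shift \<Gamma>))"
proof -
  note G = assms(2) and \<Gamma> = assms(3,4)
  note right = hankel_mult_diff_opmat[OF G]
  note left = adjoint_diff_opmat_mult_hankel[of G]
  have comm: "opmat_minus (opmat_mult (hankel_opmat G) diff_opmat)
                 (opmat_mult (opmat_adjoint diff_opmat) (hankel_opmat G))
       = (\<lambda>i j h. of_int (int j - int i) *\<^sub>C ext_coeff G (int i + int j - 1) h)"
    by (simp add: opmat_minus_def right left scaleC_diff_left)
  note similar = similar_to_contraction_weighted_hankel[OF G \<Gamma>]
  have "similar_to_contraction (block_upper (cadjoint shift) shift \<Gamma>)"
    if "defines_bounded_operator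
          (\<lambda>i j h. of_int (int j - int i) *\<^sub>C ext_coeff G (int i + int j - 1) h)"
    by (rule similar[OF that, where c = 2]) simp_all
  moreover have "similar_to_contraction (block_upper (cadjoint shift) shift \<Gamma>)"
    if "defines_bounded_operator (\<lambda>i j h. of_nat j *\<^sub>C ext_coeff G (int i + int j - 1) h)"
    by (rule similar[OF that, where c = 1]) simp_all
  moreover have "similar_to_contraction (block_upper (cadjoint shift) shift \<Gamma>)"
    if "defines_bounded_operator (\<lambda>i j h. of_nat i *\<^sub>C ext_coeff G (int i + int j - 1) h)"
    by (rule similar[OF that, where c = "- 1"]) simp_all
  ultimately show ?thesis
    unfolding comm unfolding right left by blast
qed

end
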